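(* For every integer $k\geq 2$ there exists an infinite family of $(k-1)$-diregular directed graphs (every vertex has in-degree and out-degree equal to $k-1$) each of which is $k$-ordered hamiltonian.
   Context: Directed graphs are finite, without loops or multiple arcs. A directed graph $D$ is $r$-ordered hamiltonian if, for every sequence $v_1, \ldots, v_r$ of $r$ distinct vertices of $D$, there exists a directed hamiltonian cycle in $D$ (a directed cycle through all vertices) containing $v_1, \ldots, v_r$ in this (cyclic) order. *)

theory Defs
  imports "Graph_Theory.Graph_Theory" "HOL-Library.Sublist"
begin

definition diregular :: "nat \<Rightarrow> ('a, 'b) pre_digraph \<Rightarrow> bool" where
  "diregular d G \<longleftrightarrow> (\<forall>v \<in> verts G. in_degree G v = d \<and> out_degree G v = d)"

(* A cycle is a closed arc list, so the tails of its arcs list each of its vertices exactly once. *)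
definition hamiltonian_cycle :: "('a, 'b) pre_digraph \<Rightarrow> 'b awalk \<Rightarrow> bool" where
  "hamiltonian_cycle G p \<longleftrightarrow> pre_digraph.cycle G p \<and> set (map (tail G) p) = verts G"

(* The cyclic order is that of the vertex list up to the choice of starting vertex, hence the
   rotation. *)
definition visits_in_order :: "('a, 'b) pre_digraph \<Rightarrow> 'b awalk \<Rightarrow> 'a list \<Rightarrow> bool" where
  "visits_in_order G p vs \<longleftrightarrow> (\<exists>n. subseq vs (rotate n (map (tail G) p)))"

definition ordered_hamiltonian :: "nat \<Rightarrow> ('a, 'b) pre_digraph \<Rightarrow> bool" where
  "ordered_hamiltonian r G \<longleftrightarrow>
    (\<forall>vs. length vs = r \<and> distinct vs \<and> set vs \<subseteq> verts G \<longrightarrow>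
      (\<exists>p. hamiltonian_cycle G p \<and> visits_in_order G p vs))"

end

theory Submission
  imports Defs
begin

text \<open>
  Let \<open>d = k - 1\<close> and blow up a directed cycle of length \<open>m \<ge> 2\<close>, replacing every vertex by a
  layer of \<open>d\<close> independent vertices. A Hamiltonian cycle winds \<open>d\<close> times around the layers, and
  conversely any enumeration of the vertices which advances one layer at each step is a Hamiltonian
  cycle. Hence \<open>k\<close> prescribed vertices can be met greedily, each at most \<open>m\<close> steps after its
  predecessor. The last one is then met at time at most \<open>d * m\<close>, with equality only if all \<open>k\<close>
  vertices lie in one layer, which is impossible because a layer has only \<open>d < k\<close> vertices.
\<close>

section \<open>The blown-up cycle and its degrees\<close>

text \<open>The layer of a vertex is its residue modulo \<open>m\<close>. Arcs are the pairs of
  their ends, which rules out multiple arcs.\<close>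

definition cycle_blowup :: "nat \<Rightarrow> nat \<Rightarrow> (nat, nat \<times> nat) pre_digraph" where
  "cycle_blowup d m =
    \<lparr>verts = {..<d * m},
     arcs = {(u, v). u < d * m \<and> v < d * m \<and> v mod m = Suc u mod m},
     tail = fst, head = snd\<rparr>"

lemma cycle_blowup_simps [simp]:
  "verts (cycle_blowup d m) = {..<d * m}"
  "arcs (cycle_blowup d m) = {(u, v). u < d * m \<and> v < d * m \<and> v mod m = Suc u mod m}"
  "tail (cycle_blowup d m) = fst"
  "head (cycle_blowup d m) = snd"
  by (simp_all add: cycle_blowup_def)

text \<open>Division by \<open>m\<close> parametrises a layer by the quotients \<open>a < d\<close>.
  The count yields both degrees and, later, the contradiction when \<open>d + 1\<close> vertices
  share a layer.\<close>

lemma card_residue_class: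
  fixes d m r :: nat
  assumes "r < m"
  shows "card {v. v < d * m \<and> v mod m = r} = d"
proof -
  have "{v. v < d * m \<and> v mod m = r} = (\<lambda>a. r + m * a) ` {..<d}"
  proof (intro set_eqI iffI)
    fix v assume "v \<in> {v. v < d * m \<and> v mod m = r}"
    then have v: "v < d * m" "v mod m = r" by auto
    then have "v div m < d" by (simp add: less_mult_imp_div_less)
    moreover have "v = r + m * (v div m)" using v by (metis mod_mult_div_eq)
    ultimately show "v \<in> (\<lambda>a. r + m * a) ` {..<d}" by blast
  next
    fix v assume "v \<in> (\<lambda>a. r + m * a) ` {..<d}"
    then obtain a where a: "a < d" "v = r + m * a" by blast
    have "r + m * a < m * Suc a" using assms by simp
    also have "\<dots> \<le> m * d" using a by (intro mult_le_mono2) simp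
    finally show "v \<in> {v. v < d * m \<and> v mod m = r}"
      using a assms by (simp add: mult.commute)
  qed
  moreover have "inj_on (\<lambda>a. r + m * a) {..<d}" using assms by (auto simp: inj_on_def)
  ultimately show ?thesis by (simp add: card_image)
qed

text \<open>Adding \<open>m - 1\<close> is subtracting 1 modulo \<open>m\<close>. This form exhibits
  the in-neighbours of \<open>v\<close> as a full layer.\<close>

lemma Suc_mod_eq_iff:
  fixes m u v :: nat
  assumes "m > 0"
  shows "Suc u mod m = v mod m \<longleftrightarrow> u mod m = (v + (m - 1)) mod m"
proof
  assume "Suc u mod m = v mod m"
  then have "(Suc u + (m - 1)) mod m = (v + (m - 1)) mod m" by (metis mod_add_left_eq)
  then show "u mod m = (v + (m - 1)) mod m" using assms by simp
next
  assume "u mod m = (v + (m - 1)) mod m"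
  then have "(u + 1) mod m = (v + (m - 1) + 1) mod m" by (metis mod_add_left_eq)
  then show "Suc u mod m = v mod m" using assms by simp
qed

lemma Suc_mod_neq:
  fixes m u :: nat
  assumes "m \<ge> 2"
  shows "u mod m \<noteq> Suc u mod m"
  using assms unfolding mod_Suc by (simp split: if_split)

lemma digraph_cycle_blowup:
  assumes "m \<ge> 2"
  shows "digraph (cycle_blowup d m)"
proof
  have "arcs (cycle_blowup d m) \<subseteq> {..<d * m} \<times> {..<d * m}" by auto
  then show "finite (arcs (cycle_blowup d m))" by (rule finite_subset) simp
next
  fix e assume "e \<in> arcs (cycle_blowup d m)"
  then show "tail (cycle_blowup d m) e \<noteq> head (cycle_blowup d m) e"
    using Suc_mod_neq[OF assms] by force
qed (auto simp: arc_to_ends_def)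

lemma diregular_cycle_blowup:
  assumes "m > 0"
  shows "diregular d (cycle_blowup d m)"
  unfolding diregular_def
proof (intro ballI conjI)
  fix v assume "v \<in> verts (cycle_blowup d m)"
  then have v: "v < d * m" by simp
  have "in_arcs (cycle_blowup d m) v =
      (\<lambda>u. (u, v)) ` {u. u < d * m \<and> u mod m = (v + (m - 1)) mod m}"
    using v by (auto simp: in_arcs_def eq_commute[of "v mod m"] Suc_mod_eq_iff[OF assms])
  then show "in_degree (cycle_blowup d m) v = d"
    using assms by (simp add: in_degree_def card_image inj_on_def card_residue_class)
  have "out_arcs (cycle_blowup d m) v = Pair v ` {u. u < d * m \<and> u mod m = Suc v mod m}"
    using v by (auto simp: out_arcs_def)
  then show "out_degree (cycle_blowup d m) v = d"
    using assms by (simp add: out_degree_def card_image inj_on_def card_residue_class)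
qed

section \<open>Hamiltonian cycles from layered enumerations\<close>

lemma cas_map_upt:
  assumes "tail G = fst" "head G = snd" "i \<le> j"
  shows "pre_digraph.cas G (e i) (map (\<lambda>t. (e t, e (Suc t))) [i..<j]) (e j) \<and>
    pre_digraph.awalk_verts G (e i) (map (\<lambda>t. (e t, e (Suc t))) [i..<j]) = map e [i..<Suc j]"
  using assms(3)
\<comment> \<open>The recursion of \<open>cas\<close> and \<open>awalk_verts\<close> peels off the
  first arc, so the start \<open>i\<close> descends from \<open>j\<close>.\<close>
proof (induction rule: inc_induct)
  case base
  then show ?case by (simp add: pre_digraph.cas.simps pre_digraph.awalk_verts.simps)
next
  case (step n)
  then show ?case
    using assms(1,2)
    by (simp add: pre_digraph.cas.simps pre_digraph.awalk_verts.simps upt_rec[of n])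
qed

lemma hamiltonian_cycle_cycle_blowup:
  assumes "d > 0" "m > 0"
    and bij: "bij_betw c {..<d * m} {..<d * m}"
    and layer: "\<And>t. t < d * m \<Longrightarrow> c t mod m = (s + t) mod m"
  shows "\<exists>p. hamiltonian_cycle (cycle_blowup d m) p \<and>
    map (tail (cycle_blowup d m)) p = map c [0..<d * m]"
proof -
  define n where "n = d * m"
  have n: "n > 0" using assms n_def by simp
  let ?G = "cycle_blowup d m"
  \<comment> \<open>Periodic continuation of \<open>c\<close>: the closing arc, from time
    \<open>n - 1\<close> back to time 0, gets the same form as the others.\<close>
  define e where "e t = c (t mod n)" for t
  define p where "p = map (\<lambda>t. (e t, e (Suc t))) [0..<n]"
  have e_less: "e t < n" for t
    using bij n unfolding e_def n_def bij_betw_def by auto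
  have e_layer: "e t mod m = (s + t) mod m" for t
  proof -
    have "e t mod m = (s + t mod n) mod m" using layer n by (simp add: e_def n_def)
    \<comment> \<open>Since \<open>m\<close> divides \<open>n\<close>, wrapping around after
      \<open>n\<close> steps respects the layers.\<close>
    also have "\<dots> = (s + t) mod m"
      by (metis mod_add_right_eq mod_mod_cancel dvd_triv_right n_def)
    finally show ?thesis .
  qed
  have e_Suc: "e (Suc t) mod m = Suc (e t) mod m" for t
    using e_layer[of t] e_layer[of "Suc t"] by (metis add_Suc_right mod_Suc_eq)
  have tails: "map fst p = map c [0..<n]" by (simp add: p_def e_def)
  have walk: "pre_digraph.cas ?G (e 0) p (e n)"
    "pre_digraph.awalk_verts ?G (e 0) p = map e [0..<Suc n]"
    using cas_map_upt[of ?G 0 n e] unfolding p_def by auto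
  have "e n = e 0" by (simp add: e_def)
  \<comment> \<open>A cycle requires distinct vertices after the first entry of the vertex list;
    these are the times 1 to \<open>n\<close>, with \<open>n\<close> standing for time 0.\<close>
  have "inj_on e {Suc 0..<Suc n}"
  proof (rule inj_onI)
    fix x y assume xy: "x \<in> {Suc 0..<Suc n}" "y \<in> {Suc 0..<Suc n}" "e x = e y"
    then have "x mod n = y mod n"
      using bij n unfolding e_def n_def bij_betw_def inj_on_def by simp
    with xy show "x = y"
      by (cases "x = n"; cases "y = n") auto
  qed
  then have "distinct (tl (map e [0..<Suc n]))"
    by (simp add: distinct_map upt_conv_Cons del: upt_Suc)
  moreover have "pre_digraph.awalk ?G (e 0) p (e 0)"
    using walk(1) e_less e_Suc \<open>e n = e 0\<close>
    by (auto simp: pre_digraph.awalk_def p_def n_def)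
  moreover have "p \<noteq> []" using n by (simp add: p_def)
  ultimately have "pre_digraph.cycle ?G p"
    using walk(2) unfolding pre_digraph.cycle_def by auto
  moreover have "set (map fst p) = {..<n}"
    using bij unfolding tails by (simp add: bij_betw_def n_def lessThan_atLeast0)
  ultimately show ?thesis
    using tails unfolding hamiltonian_cycle_def n_def by (intro exI[of _ p]) simp
qed

section \<open>Rearranging an enumeration within its layers\<close>

lemma bij_betw_extend_layered:
  fixes k :: nat
  assumes "bij_betw c A B" "inj_on t {..<k}" "inj_on v {..<k}"
    and "t ` {..<k} \<subseteq> A" "v ` {..<k} \<subseteq> B"
    and "\<And>j. j < k \<Longrightarrow> l (c (t j)) = l (v j)"
  shows "\<exists>c'. bij_betw c' A B \<and> (\<forall>x\<in>A. l (c' x) = l (c x)) \<and> (\<forall>j<k. c' (t j) = v j)"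
  using assms(2-)
proof (induction k)
  case 0
  then show ?case using assms(1) by auto
next
  case (Suc k)
  then obtain b where b: "bij_betw b A B" "\<forall>x\<in>A. l (b x) = l (c x)" "\<forall>j<k. b (t j) = v j"
    by (fastforce simp: lessThan_Suc)
  let ?tr = "transpose (b (t k)) (v k)"
  have tk: "t k \<in> A" and vk: "v k \<in> B" using Suc.prems by auto
  then have btk: "b (t k) \<in> B" using b(1) by (auto simp: bij_betw_def)
  have "bij_betw ?tr B B"
    using btk vk by (auto simp: bij_betw_def inj_on_def transpose_def image_iff)
  then have "bij_betw (?tr \<circ> b) A B" using b(1) bij_betw_trans by blast
  moreover have "l (b (t k)) = l (v k)" using tk b(2) Suc.prems(5) by simp
  then have "l (?tr y) = l y" for y unfolding transpose_def by (cases "y = b (t k)") auto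
  then have "l ((?tr \<circ> b) x) = l (c x)" if "x \<in> A" for x using that b(2) by simp
  moreover have "(?tr \<circ> b) (t j) = v j" if "j < Suc k" for j
  proof (cases "j = k")
    case False
    then have j: "j < k" using that by simp
    \<comment> \<open>An earlier value \<open>v j = b (t j)\<close> differs from both swapped
      elements \<open>v k\<close> and \<open>b (t k)\<close>, so the transposition fixes it.\<close>
    then have "t j \<noteq> t k" "v j \<noteq> v k" using Suc.prems(1,2) by (auto simp: inj_on_def)
    moreover have "t j \<in> A" using Suc.prems(3) j by auto
    ultimately have "b (t j) \<noteq> b (t k)" using b(1) tk by (auto simp: bij_betw_def inj_on_def)
    with \<open>v j \<noteq> v k\<close> j b(3) show ?thesis by (simp add: transpose_def)
  qed simp
  ultimately show ?case by blast
qed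

section \<open>Greedy visiting times\<close>

lemma ex_next_residue:
  fixes m r s x :: nat
  assumes "m > 0"
  shows "\<exists>y. x < y \<and> y \<le> x + m \<and> (s + y) mod m = r mod m"
proof -
  \<comment> \<open>As \<open>m - 1\<close> acts as -1 modulo \<open>m\<close>, \<open>q\<close> is
    the number of steps from the layer at time \<open>x + 1\<close> to layer \<open>r\<close>.
    Starting at \<open>x + 1\<close> makes the new time strictly later, and \<open>q < m\<close>
    keeps it within \<open>x + m\<close>.\<close>
  define q where "q = (r + (m - 1) * (s + x + 1)) mod m"
  have "(s + (x + 1 + q)) mod m = (s + x + 1 + (r + (m - 1) * (s + x + 1))) mod m"
    unfolding q_def by (metis add.assoc mod_add_right_eq)
  also have "s + x + 1 + (r + (m - 1) * (s + x + 1)) = r + m * (s + x + 1)"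
    using assms by (cases m) (simp_all add: algebra_simps)
  also have "\<dots> mod m = r mod m" by (rule mod_mult_self2)
  finally have "(s + (x + 1 + q)) mod m = r mod m" .
  moreover have "q < m" using assms by (simp add: q_def)
  ultimately show ?thesis by (intro exI[of _ "x + 1 + q"]) auto
qed

lemma greedy_times:
  fixes m :: nat and v :: "nat \<Rightarrow> nat"
  assumes "m > 0"
  obtains t where "t 0 = 0" "strict_mono t" "\<And>j. t (Suc j) \<le> t j + m"
    "\<And>j. (v 0 + t j) mod m = v j mod m"
proof -
  have "\<exists>t. \<forall>j. ((v 0 + t j) mod m = v j mod m \<and> (j = 0 \<longrightarrow> t j = 0)) \<and>
      (t j < t (Suc j) \<and> t (Suc j) \<le> t j + m)"
  proof (rule dependent_nat_choice)
    show "\<exists>x. (v 0 + x) mod m = v 0 mod m \<and> (0 = (0 :: nat) \<longrightarrow> x = 0)"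
      by (rule exI[of _ 0]) simp
  next
    fix x j
    show "\<exists>y. ((v 0 + y) mod m = v (Suc j) mod m \<and> (Suc j = 0 \<longrightarrow> y = 0)) \<and>
        x < y \<and> y \<le> x + m"
      using ex_next_residue[OF assms, of x "v 0" "v (Suc j)"] by auto
  qed
  then show thesis using that by (metis strict_mono_Suc_iff)
qed

lemma increments_bound:
  fixes t :: "nat \<Rightarrow> nat"
  assumes "\<And>j. t (Suc j) \<le> t j + m"
  shows "t (i + j) \<le> t i + j * m"
proof (induction j)
  case (Suc j)
  then show ?case using assms[of "i + j"] by simp
qed simp

lemma strictly_increasing_subseq_upt:
  fixes t :: "nat \<Rightarrow> nat"
  assumes "strict_mono t" "\<And>j. j < k \<Longrightarrow> t j < n"
  shows "subseq (map t [0..<k]) [0..<n]"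
proof -
  have "sorted_wrt (<) (map t [0..<k])"
    using assms(1) by (simp add: sorted_wrt_map strict_mono_less)
  \<comment> \<open>Both sides are strictly sorted lists with the same elements; a filtered list is
    a subsequence.\<close>
  then have "map t [0..<k] = filter (\<lambda>x. x \<in> t ` {..<k}) [0..<n]"
    using assms(2)
    by (intro strict_sorted_equal) (auto simp: sorted_wrt_filter atLeast0LessThan)
  then show ?thesis by simp
qed

section \<open>Prescribed vertices on a Hamiltonian cycle\<close>

lemma ordered_hamiltonian_cycle_blowup:
  assumes "d > 0" "m > 0"
  shows "ordered_hamiltonian (Suc d) (cycle_blowup d m)"
  unfolding ordered_hamiltonian_def
proof (intro allI impI)
  fix vs :: "nat list"
  assume "length vs = Suc d \<and> distinct vs \<and> set vs \<subseteq> verts (cycle_blowup d m)"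
  then have vs: "length vs = Suc d" "distinct vs" "set vs \<subseteq> {..<d * m}" by auto
  define n where "n = d * m"
  define s where "s = vs ! 0"
  \<comment> \<open>Times exist for any infinite sequence of numbers, so the unspecified entries
    \<open>vs ! j\<close> with \<open>j > d\<close> do no harm.\<close>
  obtain t where t: "t 0 = 0" "strict_mono t" "\<And>j. t (Suc j) \<le> t j + m"
    and t_layer: "\<And>j. (s + t j) mod m = vs ! j mod m"
    using greedy_times[OF assms(2), of "\<lambda>j. vs ! j"] unfolding s_def by metis
  have "t d \<noteq> n"
  proof
    assume "t d = n"
    have "vs ! j \<in> {v. v < d * m \<and> v mod m = s mod m}" if "j < Suc d" for j
    proof -
      have "t j \<le> j * m" using increments_bound[of t m 0 j] t by simp
      \<comment> \<open>The lower bound on \<open>t j\<close> comes from the far end: the remaining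
        \<open>d - j\<close> increments cover at most \<open>(d - j) * m\<close>, yet reach
        \<open>d * m\<close>.\<close>
      moreover have "j * m + (d - j) * m = d * m"
        using that by (simp flip: add_mult_distrib)
      then have "j * m \<le> t j"
        using increments_bound[of t m j "d - j"] t(3) that \<open>t d = n\<close> by (simp add: n_def)
      ultimately have "vs ! j mod m = s mod m" using t_layer[of j] by simp
      moreover have "vs ! j \<in> set vs" using vs(1) that by simp
      ultimately show ?thesis using vs(3) by auto
    qed
    then have "set vs \<subseteq> {v. v < d * m \<and> v mod m = s mod m}"
      using vs(1) by (metis (no_types, lifting) in_set_conv_nth subsetI)
    then have "card (set vs) \<le> card {v. v < d * m \<and> v mod m = s mod m}"
      by (intro card_mono) auto
    then show False
      using vs assms by (simp add: card_residue_class distinct_card)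
  qed
  moreover have "t d \<le> n" using increments_bound[of t m 0 d] t by (simp add: n_def)
  ultimately have t_less: "t j < n" if "j < Suc d" for j
    using that t(2) by (metis le_neq_implies_less less_Suc_eq_le order.strict_trans1 strict_mono_less_eq)

  \<comment> \<open>The shift by \<open>s\<close> is an initial enumeration through successive
    layers, starting at \<open>vs ! 0\<close>; at the times \<open>t j\<close> it is already in the
    right layer, and swaps within layers then put \<open>vs ! j\<close> there.\<close>
  have bij0: "bij_betw (\<lambda>x. (s + x) mod n) {..<n} {..<n}"
  proof -
    have n: "n > 0" using assms by (simp add: n_def)
    have "inj_on (\<lambda>x. (s + x) mod n) {..<n}"
    proof (rule inj_onI)
      fix x y assume xy: "x \<in> {..<n}" "y \<in> {..<n}" "(s + x) mod n = (s + y) mod n"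
      \<comment> \<open>Adding \<open>(n - 1) * s\<close> cancels \<open>s\<close> modulo
        \<open>n\<close> without subtraction.\<close>
      then have "(s + x + (n - 1) * s) mod n = (s + y + (n - 1) * s) mod n"
        by (metis mod_add_left_eq)
      moreover have "s + z + (n - 1) * s = z + n * s" for z
        using n by (cases n) simp_all
      ultimately have "(x + n * s) mod n = (y + n * s) mod n" by metis
      with xy show "x = y" by simp
    qed
    moreover have "(\<lambda>x. (s + x) mod n) ` {..<n} \<subseteq> {..<n}" using n by auto
    ultimately show ?thesis
      by (simp add: bij_betw_def endo_inj_surj)
  qed
  have layer0: "(s + x) mod n mod m = (s + x) mod m" for x
    by (simp add: n_def mod_mod_cancel)
  have "\<exists>c. bij_betw c {..<n} {..<n} \<and> (\<forall>x\<in>{..<n}. c x mod m = (s + x) mod n mod m) \<and>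
      (\<forall>j<Suc d. c (t j) = vs ! j)"
  proof (rule bij_betw_extend_layered[OF bij0])
    show "inj_on t {..<Suc d}"
      using t(2) by (meson inj_on_subset strict_mono_imp_inj_on subset_UNIV)
    show "inj_on ((!) vs) {..<Suc d}" using vs by (simp add: inj_on_nth)
    show "t ` {..<Suc d} \<subseteq> {..<n}" using t_less by auto
    show "(!) vs ` {..<Suc d} \<subseteq> {..<n}"
      using vs(1,3) by (intro image_subsetI) (metis lessThan_iff n_def nth_mem subsetD)
    show "(s + t j) mod n mod m = vs ! j mod m" for j
      using t_layer layer0 by simp
  qed
  then obtain c where c: "bij_betw c {..<n} {..<n}"
    "\<And>x. x < n \<Longrightarrow> c x mod m = (s + x) mod m" "\<And>j. j < Suc d \<Longrightarrow> c (t j) = vs ! j"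
    using layer0 by auto
  obtain p where p: "hamiltonian_cycle (cycle_blowup d m) p"
    "map (tail (cycle_blowup d m)) p = map c [0..<n]"
    using hamiltonian_cycle_cycle_blowup[OF assms, of c s] c(1,2) unfolding n_def by blast
  have "vs = map c (map t [0..<Suc d])"
    using vs(1) c(3) by (intro nth_equalityI) (auto simp del: upt_Suc)
  moreover have "subseq (map c (map t [0..<Suc d])) (map c [0..<n])"
    using strictly_increasing_subseq_upt[OF t(2) t_less] by (rule subseq_map)
  \<comment> \<open>The cycle starts at \<open>vs ! 0\<close> and all visiting times fall within one
    traversal, so the trivial rotation suffices.\<close>
  ultimately have "subseq vs (rotate 0 (map (tail (cycle_blowup d m)) p))"
    using p(2) by simp
  then show "\<exists>p. hamiltonian_cycle (cycle_blowup d m) p \<and>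
      visits_in_order (cycle_blowup d m) p vs"
    using p(1) unfolding visits_in_order_def by blast
qed

section \<open>The infinite family\<close>

lemma digraph_iso_card_verts:
  assumes "digraph_iso G H"
  shows "card (verts G) = card (verts H)"
  using assms unfolding digraph_iso_def pre_digraph.digraph_isomorphism_def
  by (auto simp: card_image)

theorem theorem5p3:
  fixes k :: nat
  assumes "k \<ge> 2"
  shows "\<exists>\<F> :: (nat, nat \<times> nat) pre_digraph set.
    infinite \<F> \<and>
    pairwise (\<lambda>G H. \<not> digraph_iso G H) \<F> \<and>
    (\<forall>G \<in> \<F>. digraph G \<and> diregular (k - 1) G \<and> ordered_hamiltonian k G)"
proof -
  define d where "d = k - 1"
  have d: "d > 0" "k = Suc d" using assms by (auto simp: d_def)
  \<comment> \<open>The order \<open>d * m\<close> determines \<open>m\<close> because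
    \<open>d > 0\<close>; this gives both the infinitude of the family and the pairwise
    non-isomorphism.\<close>
  have same: "m = m'" if "card (verts (cycle_blowup d m)) = card (verts (cycle_blowup d m'))"
    for m m'
    using that d by simp
  have "inj_on (cycle_blowup d) {2..}"
    using same by (metis inj_onI)
  then have "infinite (cycle_blowup d ` {2..})"
    using infinite_Ici finite_imageD by blast
  moreover have "pairwise (\<lambda>G H. \<not> digraph_iso G H) (cycle_blowup d ` {2..})"
    using same digraph_iso_card_verts by (fastforce simp: pairwise_def)
  moreover have "\<forall>G \<in> cycle_blowup d ` {2..}.
      digraph G \<and> diregular (k - 1) G \<and> ordered_hamiltonian k G"
    using d digraph_cycle_blowup diregular_cycle_blowup ordered_hamiltonian_cycle_blowup
    by auto
  ultimately show ?thesis by blast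
qed

end
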